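(* If $G=(V,E)$ is a $2$-connected graph on $n$ vertices, then $H(G) \ge H(C_n)$, with equality if and only if $G \cong C_n$.
   Context: Graphs are finite and simple. $C_n$ denotes the cycle on $n$ vertices. A graph is $2$-connected if it has at least $3$ vertices, is connected, and has no cut-vertex. The Harary index of a graph $G=(V,E)$ is $H(G)=\sum_{\{u,v\}\subseteq V,\,u\ne v} \frac{1}{d(u,v)}$, where $d(u,v)$ is the distance between $u$ and $v$ in $G$. *)

theory Defs
  imports "Graph_Theory.Graph_Theory"
begin

text \<open>
  A finite simple graph is a \<^locale>\<open>graph\<close>: a finite, loop-free, symmetric digraph without
  parallel arcs, in which an undirected edge is represented by a pair of opposite arcs.
\<close>

text \<open>A cut-vertex separates two other vertices of the same component.\<close>

definition cut_vertex :: "('a,'b) pre_digraph \<Rightarrow> 'a \<Rightarrow> bool" where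
  "cut_vertex G x \<longleftrightarrow> x \<in> verts G \<and>
     (\<exists>u \<in> verts G - {x}. \<exists>v \<in> verts G - {x}.
        u \<rightarrow>\<^sup>*\<^bsub>G\<^esub> v \<and> \<not> u \<rightarrow>\<^sup>*\<^bsub>pre_digraph.del_vert G x\<^esub> v)"

definition two_connected :: "('a,'b) pre_digraph \<Rightarrow> bool" where
  "two_connected G \<longleftrightarrow> card (verts G) \<ge> 3 \<and> connected G \<and> (\<forall>x \<in> verts G. \<not> cut_vertex G x)"

definition graph_dist :: "('a,'b) pre_digraph \<Rightarrow> 'a \<Rightarrow> 'a \<Rightarrow> real" where
  "graph_dist G u v = real_of_ereal (wf_digraph.\<mu> G (\<lambda>_. 1) u v)"

text \<open>
  The description operator lifts the reciprocal distance to unordered pairs; it is well defined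
  because the distance in a \<^locale>\<open>graph\<close> is symmetric.
\<close>

definition harary_index :: "('a,'b) pre_digraph \<Rightarrow> real" where
  "harary_index G =
     (\<Sum>e | e \<subseteq> verts G \<and> card e = 2. THE r. \<exists>u v. e = {u, v} \<and> r = 1 / graph_dist G u v)"

text \<open>The cycle on \<open>{0, \<dots>, n - 1}\<close>; it is a simple graph for \<open>n \<ge> 3\<close>.\<close>

definition cycle_graph :: "nat \<Rightarrow> (nat, nat \<times> nat) pre_digraph" where
  "cycle_graph n = with_proj
     \<lparr> pverts = {..<n},
       parcs = {(i, j). i < n \<and> j < n \<and> (j = Suc i mod n \<or> i = Suc j mod n)} \<rparr>"

lemma graph_cycle_graph:
  assumes "n \<ge> 3"
  shows "graph (cycle_graph n)"
proof -
  have fin: "finite {(i, j). i < n \<and> j < n \<and> (j = Suc i mod n \<or> i = Suc j mod n)}"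
    by (rule finite_subset[of _ "{..<n} \<times> {..<n}"]) auto
  have ne: "Suc i mod n \<noteq> i" if "i < n" for i
    using assms that by (cases "Suc i = n") auto
  show ?thesis
    unfolding cycle_graph_def
  proof (unfold_locales, goal_cases)
    case 7 then show ?case by (auto simp: symmetric_def sym_def)
  qed (use fin ne in \<open>auto simp: arc_to_ends_def, metis+\<close>)
qed

lemma awalk_rev_length:
  assumes "sym_digraph G" "pre_digraph.awalk G u p v"
  shows "\<exists>q. pre_digraph.awalk G v q u \<and> length q = length p"
proof -
  interpret sym_digraph G by fact
  show ?thesis using assms(2)
  proof (induction p arbitrary: u)
    case Nil then show ?case by (auto simp: awalk_Nil_iff)
  next
    case (Cons a p)
    then have a: "a \<in> arcs G" "u = tail G a" and "awalk (head G a) p v"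
      by (auto simp: awalk_Cons_iff)
    with Cons.IH obtain q where q: "awalk v q (head G a)" "length q = length p" by blast
    from a obtain b where b: "b \<in> arcs G" "tail G b = head G a" "head G b = u"
      using sym_arcs unfolding symmetric_conv by metis
    then have "awalk (head G a) [b] u" by (auto simp: awalk_Cons_iff awalk_Nil_iff)
    with q have "awalk v (q @ [b]) u" by auto
    with q show ?case by (metis length_append_singleton length_Cons)
  qed
qed

lemma graph_dist_commute:
  assumes "sym_digraph G"
  shows "graph_dist G u v = graph_dist G v u"
proof -
  interpret sym_digraph G by fact
  have cost: "awalk_cost (\<lambda>_. 1) p = length p" for p
    by (simp add: awalk_cost_def sum_list_triv)
  have "\<mu> (\<lambda>_. 1) u v \<le> \<mu> (\<lambda>_. 1) v u" for u v
    unfolding \<mu>_def cost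
    by (rule INF_mono) (use awalk_rev_length[OF assms] in fastforce)
  then show ?thesis unfolding graph_dist_def by (metis order_antisym)
qed

lemma harary_index_pair:
  assumes "sym_digraph G"
  shows "(THE r. \<exists>x y. {u, v} = {x, y} \<and> r = 1 / graph_dist G x y) = 1 / graph_dist G u v"
  by (rule the_equality) (use graph_dist_commute[OF assms] in \<open>auto simp: doubleton_eq_iff\<close>)

end

theory Submission
  imports Defs
begin

text \<open>
  Twice the Harary index is the sum over all vertices \<open>u\<close> of the reciprocal distances from \<open>u\<close>.
  Abel summation turns the contribution of \<open>u\<close> into a positive combination of the numbers of
  vertices other than \<open>u\<close> within distance \<open>i\<close> of \<open>u\<close>. In a 2-connected graph every distance layer
  around \<open>u\<close> except the last has at least two vertices, so these numbers are at least
  \<open>min (2 * i) (n - 1)\<close>, while in the cycle they are at most that. If equality holds, then the case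
  \<open>i = 1\<close> says that all degrees are 2, and a connected 2-regular graph is a cycle.
\<close>

section \<open>Balls around a vertex and their relation to distance\<close>

text \<open>Defined by walk lengths rather than by \<open>graph_dist\<close>, whose value 0 for
  unreachable vertices would put them into every ball.\<close>

definition (in wf_digraph) hop_ball :: "'a \<Rightarrow> nat \<Rightarrow> 'a set" where
  "hop_ball u i = {v. \<exists>p. awalk u p v \<and> length p \<le> i}"

definition reciprocal_transmission :: "('a,'b) pre_digraph \<Rightarrow> 'a \<Rightarrow> real" where
  "reciprocal_transmission G v = (\<Sum>u \<in> verts G - {v}. 1 / graph_dist G v u)"

context wf_digraph
begin

lemma hop_ball_0: "u \<in> verts G \<Longrightarrow> hop_ball u 0 = {u}"
  by (auto simp: hop_ball_def awalk_Nil_iff)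

lemma hop_ball_subset_verts: "hop_ball u i \<subseteq> verts G"
  by (auto simp: hop_ball_def)

lemma self_in_hop_ball: "u \<in> verts G \<Longrightarrow> u \<in> hop_ball u i"
  unfolding hop_ball_def by (auto simp: awalk_Nil_iff intro!: exI[of _ "[]"])

lemma hop_ball_Suc: "hop_ball u (Suc i) = hop_ball u i \<union> {w. \<exists>v \<in> hop_ball u i. v \<rightarrow> w}"
proof (intro set_eqI iffI)
  fix w assume "w \<in> hop_ball u (Suc i)"
  then obtain p where p: "awalk u p w" "length p \<le> Suc i" by (auto simp: hop_ball_def)
  show "w \<in> hop_ball u i \<union> {w. \<exists>v \<in> hop_ball u i. v \<rightarrow> w}"
  proof (cases p rule: rev_cases)
    case Nil
    with p show ?thesis by (auto simp: hop_ball_def)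
  next
    case (snoc q a)
    with p have "awalk u q (tail G a)" "length q \<le> i" "a \<in> arcs G" "head G a = w"
      by (auto simp: awalk_simps)
    then show ?thesis
      by (auto simp: hop_ball_def dest: in_arcs_imp_in_arcs_ends)
  qed
next
  fix w assume "w \<in> hop_ball u i \<union> {w. \<exists>v \<in> hop_ball u i. v \<rightarrow> w}"
  then show "w \<in> hop_ball u (Suc i)"
  proof
    assume "w \<in> hop_ball u i"
    then show ?thesis by (force simp: hop_ball_def)
  next
    assume "w \<in> {w. \<exists>v \<in> hop_ball u i. v \<rightarrow> w}"
    then obtain v p a where "awalk u p v" "length p \<le> i" "a \<in> arcs G" "tail G a = v" "head G a = w"
      by (auto simp: hop_ball_def)
    then have "awalk u (p @ [a]) w" "length (p @ [a]) \<le> Suc i"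
      by (auto simp: awalk_simps)
    then show ?thesis unfolding hop_ball_def by blast
  qed
qed

text \<open>The infimum of the walk lengths is attained if a walk exists. Otherwise it is infinite
  and \<open>real_of_ereal\<close> turns it into 0; the balls tell the two cases apart.\<close>

lemma graph_dist_hop_ball_cases:
  obtains (unreachable) "graph_dist G u v = 0" "\<And>i. v \<notin> hop_ball u i"
  | (reachable) k where "graph_dist G u v = real k" "\<And>i. v \<in> hop_ball u i \<longleftrightarrow> k \<le> i"
proof (cases "u \<rightarrow>\<^sup>* v")
  case False
  then have "\<mu> (\<lambda>_. 1) u v = \<infinity>" by (rule shortest_path_inf)
  moreover have "v \<notin> hop_ball u i" for i
    using False by (auto simp: hop_ball_def reachable_awalk)
  ultimately show ?thesis using unreachable by (simp add: graph_dist_def)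
next
  case True
  have cost: "awalk_cost (\<lambda>_. 1) p = length p" for p
    by (simp add: awalk_cost_def sum_list_triv)
  define k where "k = (LEAST k. \<exists>p. awalk u p v \<and> length p = k)"
  from True obtain p0 where "awalk u p0 v" by (auto simp: reachable_awalk)
  then have "\<exists>k. \<exists>p. awalk u p v \<and> length p = k" by blast
  then have "\<exists>p. awalk u p v \<and> length p = k" unfolding k_def by (rule LeastI_ex)
  then obtain p where p: "awalk u p v" "length p = k" by blast
  have least: "k \<le> length q" if "awalk u q v" for q
    unfolding k_def by (rule Least_le) (use that in blast)
  have "\<mu> (\<lambda>_. 1) u v = ereal (real k)"
    unfolding \<mu>_def cost
  proof (rule INF_eqI)
    fix y assume "\<And>i. i \<in> {p. awalk u p v} \<Longrightarrow> y \<le> ereal (real (length i))"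
    then show "y \<le> ereal (real k)" using p by blast
  qed (use least in auto)
  moreover have "v \<in> hop_ball u i \<longleftrightarrow> k \<le> i" for i
    using p least by (fastforce simp: hop_ball_def)
  ultimately show ?thesis using reachable by (simp add: graph_dist_def)
qed

text \<open>Reachability cannot leave a set closed under adjacency. Applied to a ball that stops
  growing and to the vertices of a longest path.\<close>

lemma strongly_connected_closed_set:
  assumes "strongly_connected G" "u \<in> S" "S \<subseteq> verts G" "\<And>x y. x \<in> S \<Longrightarrow> x \<rightarrow> y \<Longrightarrow> y \<in> S"
  shows "S = verts G"
proof (rule antisym[OF assms(3)], rule subsetI)
  fix w assume "w \<in> verts G"
  with assms have "u \<rightarrow>\<^sup>* w" by (auto simp: strongly_connected_def)
  then show "w \<in> S" by (induction rule: reachable_induct) (use assms in auto)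
qed

end

section \<open>Abel summation of reciprocal distances\<close>

text \<open>The indicator discards the terms with \<open>i < k\<close> and the rest telescopes: Abel
  summation for a single distance \<open>k\<close>.\<close>

lemma inverse_telescope:
  fixes k N :: nat
  assumes "k \<le> N" "1 \<le> k"
  shows "(\<Sum>i = 1..<N. (1 / real i - 1 / real (Suc i)) * of_bool (k \<le> i)) = 1 / real k - 1 / real N"
proof -
  have "(\<Sum>i = 1..<N. (1 / real i - 1 / real (Suc i)) * of_bool (k \<le> i)) =
      (\<Sum>i = k..<N. 1 / real i - 1 / real (Suc i))"
    by (rule sum.mono_neutral_cong_right) (use assms in auto)
  also have "\<dots> = - (\<Sum>i = k..<N. 1 / real (Suc i) - 1 / real i)"
    by (simp add: sum_negf[symmetric] del: of_nat_Suc)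
  also have "\<dots> = 1 / real k - 1 / real N"
    using assms by (subst sum_Suc_diff') auto
  finally show ?thesis .
qed

text \<open>
  The result of Abel summation for \<open>n - 1\<close> reciprocal distances at most \<open>n\<close>, of which \<open>f i\<close> come from
  distances at most \<open>i\<close>.
\<close>

definition layer_sum :: "nat \<Rightarrow> (nat \<Rightarrow> nat) \<Rightarrow> real" where
  "layer_sum n f = (real n - 1) / real n
     + (\<Sum>i = 1..<n. (1 / real i - 1 / real (Suc i)) * real (f i))"

lemma layer_sum_mono:
  assumes "\<And>i. 1 \<le> i \<Longrightarrow> i < n \<Longrightarrow> f i \<le> g i"
  shows "layer_sum n f \<le> layer_sum n g"
  unfolding layer_sum_def
  by (intro add_left_mono sum_mono mult_left_mono) (use assms in \<open>auto simp: field_simps\<close>)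

text \<open>All weights \<open>1 / i - 1 / (i + 1)\<close> are strictly positive, so termwise
  ordered sums agree only if every term does.\<close>

lemma layer_sum_eq_imp_eq:
  assumes le: "\<And>i. 1 \<le> i \<Longrightarrow> i < n \<Longrightarrow> f i \<le> g i" and eq: "layer_sum n f = layer_sum n g"
    and i: "1 \<le> i" "i < n"
  shows "f i = g i"
proof -
  have mono: "(1 / real i - 1 / real (Suc i)) * real (f i) \<le> (1 / real i - 1 / real (Suc i)) * real (g i)"
    if "i \<in> {1..<n}" for i
    by (rule mult_left_mono) (use le that in \<open>auto simp: field_simps\<close>)
  have "(1 / real i - 1 / real (Suc i)) * real (f i) = (1 / real i - 1 / real (Suc i)) * real (g i)"
    by (rule sum_mono_inv[where I = "{1..<n}" and i = i
          and f = "\<lambda>i. (1 / real i - 1 / real (Suc i)) * real (f i)"])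
      (use eq i mono in \<open>simp_all add: layer_sum_def\<close>)
  moreover have "1 / real i - 1 / real (Suc i) > 0" using i by (simp add: frac_less2)
  ultimately show ?thesis by simp
qed

text \<open>Up to distance \<open>N\<close> this is the telescoping identity. Beyond it, or for
  unreachable \<open>v\<close>, the left side is at most \<open>1 / N\<close>, so only the
  inequality remains.\<close>

lemma (in wf_digraph) inverse_graph_dist_layers:
  assumes "u \<in> verts G" "u \<noteq> v" "0 < N"
  defines "s \<equiv> 1 / real N + (\<Sum>i = 1..<N. (1 / real i - 1 / real (Suc i)) * of_bool (v \<in> hop_ball u i))"
  shows "1 / graph_dist G u v \<le> s"
    and "v \<in> hop_ball u N \<Longrightarrow> 1 / graph_dist G u v = s"
proof -
  have nonneg: "0 \<le> (\<Sum>i = 1..<N. (1 / real i - 1 / real (Suc i)) * of_bool (P i))" for P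
    by (intro sum_nonneg mult_nonneg_nonneg) (auto simp: field_simps)
  have "1 / graph_dist G u v \<le> s \<and> (v \<in> hop_ball u N \<longrightarrow> 1 / graph_dist G u v = s)"
  proof (cases rule: graph_dist_hop_ball_cases[of u v])
    case unreachable
    then show ?thesis using nonneg[of "\<lambda>i. v \<in> hop_ball u i"] by (simp add: s_def)
  next
    case (reachable k)
    have k: "1 \<le> k"
      using reachable(2)[of 0] hop_ball_0[OF assms(1)] assms(2) by auto
    show ?thesis
    proof (cases "k \<le> N")
      case True
      then show ?thesis using inverse_telescope[OF True k] by (simp add: s_def reachable)
    next
      case False
      then have "1 / real k \<le> 1 / real N" using \<open>0 < N\<close> by (simp add: frac_le)
      then show ?thesis using nonneg[of "\<lambda>i. k \<le> i"] False reachable by (simp add: s_def)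
    qed
  qed
  then show "1 / graph_dist G u v \<le> s" "v \<in> hop_ball u N \<Longrightarrow> 1 / graph_dist G u v = s" by auto
qed

text \<open>Summing the layer formula with \<open>N = n\<close> over \<open>v\<close> and swapping
  the sums turns indicators into ball sizes and the constants \<open>1 / n\<close> into
  \<open>(n - 1) / n\<close>. The inequality is applied to the cycle, the equation to the
  2-connected graph.\<close>

lemma (in fin_digraph) reciprocal_transmission_layer_sum:
  assumes u: "u \<in> verts G"
  defines "n \<equiv> card (verts G)"
  shows "reciprocal_transmission G u \<le> layer_sum n (\<lambda>i. card (hop_ball u i - {u}))"
    and "verts G \<subseteq> hop_ball u n \<Longrightarrow>
      reciprocal_transmission G u = layer_sum n (\<lambda>i. card (hop_ball u i - {u}))"
proof -
  define s where "s v = 1 / real n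
    + (\<Sum>i = 1..<n. (1 / real i - 1 / real (Suc i)) * of_bool (v \<in> hop_ball u i))" for v
  have n: "0 < n" using u by (auto simp: n_def card_gt_0_iff)
  have card: "(\<Sum>v \<in> verts G - {u}. of_bool (v \<in> hop_ball u i)) = real (card (hop_ball u i - {u}))" for i
  proof -
    have "(verts G - {u}) \<inter> {v. v \<in> hop_ball u i} = hop_ball u i - {u}"
      using hop_ball_subset_verts by auto
    then show ?thesis by (simp add: sum_of_bool_eq)
  qed
  have "(\<Sum>v \<in> verts G - {u}. s v) = (real n - 1) / real n +
      (\<Sum>v \<in> verts G - {u}. \<Sum>i = 1..<n. (1 / real i - 1 / real (Suc i)) * of_bool (v \<in> hop_ball u i))"
    using u n by (simp add: s_def sum.distrib n_def of_nat_diff Suc_le_eq)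
  also have "\<dots> = layer_sum n (\<lambda>i. card (hop_ball u i - {u}))"
    unfolding layer_sum_def by (subst sum.swap) (simp add: sum_distrib_left[symmetric] card)
  finally have s: "(\<Sum>v \<in> verts G - {u}. s v) = layer_sum n (\<lambda>i. card (hop_ball u i - {u}))" .
  show "reciprocal_transmission G u \<le> layer_sum n (\<lambda>i. card (hop_ball u i - {u}))"
    unfolding reciprocal_transmission_def s[symmetric] s_def
    by (intro sum_mono inverse_graph_dist_layers(1)) (use u n in auto)
  show "reciprocal_transmission G u = layer_sum n (\<lambda>i. card (hop_ball u i - {u}))"
    if "verts G \<subseteq> hop_ball u n"
    unfolding reciprocal_transmission_def s[symmetric] s_def
    by (intro sum.cong refl inverse_graph_dist_layers(2)) (use u n that in auto)
qed

section \<open>The Harary index as a vertex sum and its invariance under isomorphism\<close>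

text \<open>Ordered pairs are grouped by their underlying 2-element set; each set arises from
  exactly two, with equal distances by symmetry.\<close>

lemma harary_index_conv_reciprocal_transmission:
  assumes "sym_digraph G" "finite (verts G)"
  shows "2 * harary_index G = (\<Sum>v \<in> verts G. reciprocal_transmission G v)"
proof -
  let ?V = "verts G" and ?d = "\<lambda>(u, v). 1 / graph_dist G u v"
  let ?P = "SIGMA u : ?V. ?V - {u}" and ?E = "{e. e \<subseteq> ?V \<and> card e = 2}"
  have "(\<Sum>v \<in> ?V. reciprocal_transmission G v) = sum ?d ?P"
    unfolding reciprocal_transmission_def using assms by (subst sum.Sigma) auto
  also have "\<dots> = (\<Sum>e \<in> ?E. \<Sum>p | p \<in> ?P \<and> (case p of (u, v) \<Rightarrow> {u, v}) = e. ?d p)"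
    by (rule sum.group[symmetric]) (use assms in auto)
  also have "\<dots> = (\<Sum>e \<in> ?E. 2 * (THE r. \<exists>u v. e = {u, v} \<and> r = 1 / graph_dist G u v))"
  proof (rule sum.cong[OF refl])
    fix e assume "e \<in> ?E"
    then obtain a b where e: "e = {a, b}" "a \<noteq> b" "a \<in> ?V" "b \<in> ?V"
      by (auto simp: card_2_iff)
    then have "{p. p \<in> ?P \<and> (case p of (u, v) \<Rightarrow> {u, v}) = e} = {(a, b), (b, a)}"
      by (auto simp: doubleton_eq_iff)
    with e show "(\<Sum>p | p \<in> ?P \<and> (case p of (u, v) \<Rightarrow> {u, v}) = e. ?d p) =
        2 * (THE r. \<exists>u v. e = {u, v} \<and> r = 1 / graph_dist G u v)"
      using harary_index_pair[OF assms(1), of a b] graph_dist_commute[OF assms(1), of a b] by simp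
  qed
  finally show ?thesis by (simp add: harary_index_def sum_distrib_left)
qed

text \<open>An isomorphism and its inverse carry walks to walks of equal length, so both infima
  range over the same lengths.\<close>

lemma (in wf_digraph) graph_dist_app_iso:
  assumes hom: "digraph_isomorphism hom" and "u \<in> verts G" "v \<in> verts G"
  shows "graph_dist (app_iso hom G) (iso_verts hom u) (iso_verts hom v) = graph_dist G u v"
proof -
  interpret H: wf_digraph "app_iso hom G" using hom ..
  have cost: "awalk_cost (\<lambda>_. 1) p = length p" "H.awalk_cost (\<lambda>_. 1) q = length q" for p q
    by (simp_all add: awalk_cost_def H.awalk_cost_def sum_list_triv)
  have "H.\<mu> (\<lambda>_. 1) (iso_verts hom u) (iso_verts hom v) = \<mu> (\<lambda>_. 1) u v"
    unfolding \<mu>_def H.\<mu>_def cost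
  proof (rule INF_eq)
    fix p assume "p \<in> {p. H.awalk (iso_verts hom u) p (iso_verts hom v)}"
    then have "awalk u (map (iso_arcs (inv_iso hom)) p) v"
      using awalk_app_isoD[OF _ hom] assms by fastforce
    then show "\<exists>q \<in> {q. awalk u q v}. ereal (real (length q)) \<le> ereal (real (length p))"
      by (metis length_map mem_Collect_eq order_refl)
  next
    fix p assume "p \<in> {p. awalk u p v}"
    then have "H.awalk (iso_verts hom u) (map (iso_arcs hom) p) (iso_verts hom v)"
      using awalk_app_isoI[OF _ hom] by auto
    then show "\<exists>q \<in> {q. H.awalk (iso_verts hom u) q (iso_verts hom v)}.
        ereal (real (length q)) \<le> ereal (real (length p))"
      by (metis length_map mem_Collect_eq order_refl)
  qed
  then show ?thesis by (simp add: graph_dist_def)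
qed

text \<open>Vertex sums are reindexed along the isomorphism, which avoids transferring the
  description operator over 2-element sets.\<close>

lemma harary_index_digraph_iso:
  assumes "graph G" "graph H" "digraph_iso G H"
  shows "harary_index G = harary_index H"
proof -
  interpret G: graph G by fact
  interpret H: graph H by fact
  from assms(3) obtain hom where hom: "G.digraph_isomorphism hom" "H = app_iso hom G"
    by (auto simp: digraph_iso_def)
  have inj: "inj_on (iso_verts hom) (verts G)"
    using hom(1) by (rule G.digraph_isomorphism_inj_on_verts)
  have rt: "reciprocal_transmission H (iso_verts hom v) = reciprocal_transmission G v"
    if "v \<in> verts G" for v
  proof -
    have "verts H - {iso_verts hom v} = iso_verts hom ` (verts G - {v})"
      using hom inj that by (auto simp: inj_on_def)
    moreover have "inj_on (iso_verts hom) (verts G - {v})"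
      using inj by (rule inj_on_subset) auto
    ultimately show ?thesis
      using that hom by (simp add: reciprocal_transmission_def sum.reindex G.graph_dist_app_iso)
  qed
  have "2 * harary_index H = (\<Sum>v \<in> iso_verts hom ` verts G. reciprocal_transmission H v)"
    using harary_index_conv_reciprocal_transmission[OF H.sym_digraph_axioms] hom(2) by simp
  also have "\<dots> = (\<Sum>v \<in> verts G. reciprocal_transmission G v)"
    using inj rt by (simp add: sum.reindex)
  also have "\<dots> = 2 * harary_index G"
    using harary_index_conv_reciprocal_transmission[OF G.sym_digraph_axioms] by simp
  finally show ?thesis by simp
qed

section \<open>Ball sizes in 2-connected graphs\<close>

text \<open>A layer with a single vertex that does not exhaust the graph would consist of a cut-vertex.\<close>

lemma (in graph) two_connected_card_hop_ball:
  assumes "two_connected G" "u \<in> verts G"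
  shows "min (2 * i) (card (verts G) - 1) \<le> card (hop_ball u i - {u})"
proof (induction i)
  case 0
  show ?case by simp
next
  case (Suc i)
  let ?B = "hop_ball u i" and ?B' = "hop_ball u (Suc i)"
  have sc: "strongly_connected G"
    using assms(1) symmetric_connected_imp_strongly_connected[OF sym_arcs] by (simp add: two_connected_def)
  have sub: "?B \<subseteq> ?B'" "?B' \<subseteq> verts G" "u \<in> ?B"
    using self_in_hop_ball[OF assms(2)] hop_ball_subset_verts by (auto simp: hop_ball_Suc)
  then have fin: "finite ?B'" using finite_verts finite_subset by blast
  show ?case
  proof (cases "?B' = verts G")
    case True
    then show ?thesis using assms(2) by simp
  next
    case False
    then obtain w where w: "w \<in> verts G" "w \<notin> ?B'" using sub by blast
    have step: "y \<in> ?B'" if "x \<in> ?B" "x \<rightarrow> y" for x y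
      using that by (auto simp: hop_ball_Suc)
    have "2 \<le> card (?B' - ?B)"
    proof (rule ccontr)
      assume "\<not> 2 \<le> card (?B' - ?B)"
      then have "card (?B' - ?B) = 0 \<or> card (?B' - ?B) = 1" by linarith
      then consider "?B' \<subseteq> ?B" | x where "?B' - ?B = {x}"
        using fin by (auto simp: card_1_singleton_iff)
      then show False
      proof cases
        case 1
        \<comment> \<open>An empty layer makes the ball closed under adjacency, so connectedness
          forces it to be the whole graph.\<close>
        then have "?B = verts G"
          using strongly_connected_closed_set[OF sc sub(3)] sub step by blast
        with 1 sub False show False by blast
      next
        case 2
        interpret D: wf_digraph "del_vert x" by (rule wf_digraph_del_vert)
        \<comment> \<open>A walk leaving \<open>?B\<close> must first enter
          \<open>?B' - ?B = {x}\<close>, so deleting \<open>x\<close> confines it to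
          \<open>?B\<close>.\<close>
        have "y \<in> ?B" if "u \<rightarrow>\<^sup>*\<^bsub>del_vert x\<^esub> y" for y
          using that
        proof (induction rule: D.reachable_induct)
          case base
          show ?case by (rule sub)
        next
          case (step y z)
          then have "y \<rightarrow> z" "z \<noteq> x"
            by (auto simp: arcs_ends_conv del_vert_simps)
          with step \<open>\<And>x y. x \<in> ?B \<Longrightarrow> x \<rightarrow> y \<Longrightarrow> y \<in> ?B'\<close> 2 show ?case by blast
        qed
        \<comment> \<open>\<open>w\<close> is the vertex cut off from \<open>u\<close>: it lies
          outside \<open>?B'\<close>, hence outside \<open>?B\<close> and apart from
          \<open>x\<close>; \<open>u\<close> differs from \<open>x\<close> because it lies in
          \<open>?B\<close>.\<close>
        moreover have "u \<rightarrow>\<^sup>* w" using sc w assms(2) by (auto simp: strongly_connected_def)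
        ultimately have "cut_vertex G x"
          unfolding cut_vertex_def using 2 w sub assms(2) by blast
        then show False using assms(1) 2 sub by (auto simp: two_connected_def)
      qed
    qed
    moreover have "card (?B' - {u}) = card (?B - {u}) + card (?B' - ?B)"
    proof -
      have "?B' - {u} = (?B - {u}) \<union> (?B' - ?B)" using sub by blast
      moreover have "(?B - {u}) \<inter> (?B' - ?B) = {}" by blast
      ultimately show ?thesis using fin sub
        by (metis card_Un_disjoint finite_Diff finite_subset)
    qed
    ultimately show ?thesis using Suc by (simp add: min_def split: if_splits)
  qed
qed

section \<open>Ball sizes in the cycle\<close>

lemma dominates_cycle_graph:
  "i \<rightarrow>\<^bsub>cycle_graph n\<^esub> j \<longleftrightarrow> i < n \<and> j < n \<and> (j = Suc i mod n \<or> i = Suc j mod n)"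
  by (auto simp: cycle_graph_def arcs_ends_def arc_to_ends_def)

lemma verts_cycle_graph: "verts (cycle_graph n) = {..<n}"
  by (simp add: cycle_graph_def)

text \<open>At most \<open>i\<close> steps from \<open>u\<close> reach only \<open>u + j\<close>
  modulo \<open>n\<close> with \<open>-i \<le> j \<le> i\<close>; removing the centre
  \<open>j = 0\<close> leaves \<open>2 * i\<close> offsets. The other bound counts all vertices but
  \<open>u\<close>.\<close>

lemma card_hop_ball_cycle_graph:
  assumes "3 \<le> n" "u < n"
  shows "card (wf_digraph.hop_ball (cycle_graph n) u i - {u}) \<le> min (2 * i) (n - 1)"
proof -
  interpret C: graph "cycle_graph n" using assms(1) by (rule graph_cycle_graph)
  \<comment> \<open>Integer offsets let backward steps wrap around, which truncated subtraction on
    naturals would not.\<close>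
  define f where "f j = nat ((int u + j) mod int n)" for j
  have "C.hop_ball u i \<subseteq> f ` {- int i..int i}"
  proof (induction i)
    case 0
    then show ?case using assms by (simp add: C.hop_ball_0 verts_cycle_graph f_def)
  next
    case (Suc i)
    have "w \<in> f ` {- int (Suc i)..int (Suc i)}"
      if v: "v \<in> f ` {- int i..int i}" and a: "v \<rightarrow>\<^bsub>cycle_graph n\<^esub> w" for v w
    proof -
      from v obtain j where j: "v = f j" "- int i \<le> j" "j \<le> int i" by auto
      then have vj: "int v = (int u + j) mod int n" using assms by (simp add: f_def)
      from a have "w < n" "v < n" "w = Suc v mod n \<or> v = Suc w mod n"
        by (auto simp: dominates_cycle_graph)
      then have "int w = (int v + 1) mod int n \<or> int v = (int w + 1) mod int n"
        by (auto simp: zmod_int ac_simps)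
      then have "w = f (j + 1) \<or> w = f (j - 1)"
      proof
        assume "int w = (int v + 1) mod int n"
        also have "\<dots> = (int u + (j + 1)) mod int n" unfolding vj by (simp add: mod_simps ac_simps)
        finally show ?thesis unfolding f_def by (metis nat_int)
      next
        assume w: "int v = (int w + 1) mod int n"
        have "int w = int w mod int n" using \<open>w < n\<close> by simp
        also have "\<dots> = ((int w + 1) mod int n - 1) mod int n" by (simp add: mod_simps)
        also have "\<dots> = (int u + (j - 1)) mod int n"
          unfolding w[symmetric] vj by (simp add: mod_simps algebra_simps)
        finally show ?thesis unfolding f_def by (metis nat_int)
      qed
      then show ?thesis using j by auto
    qed
    moreover have "f ` {- int i..int i} \<subseteq> f ` {- int (Suc i)..int (Suc i)}" by (intro image_mono) auto
    ultimately show ?case using Suc unfolding C.hop_ball_Suc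
      by (intro Un_least subsetI) (blast intro: subsetD)+
  qed
  moreover have "f 0 = u" using assms by (simp add: f_def)
  ultimately have "C.hop_ball u i - {u} \<subseteq> f ` ({- int i..int i} - {0})" by blast
  then have "card (C.hop_ball u i - {u}) \<le> card ({- int i..int i} - {0})"
    by (rule surj_card_le[rotated]) simp
  moreover have "card (C.hop_ball u i - {u}) \<le> card ({..<n} - {u})"
    using C.hop_ball_subset_verts by (intro card_mono) (auto simp: verts_cycle_graph)
  ultimately show ?thesis using assms by simp
qed

section \<open>Connected 2-regular graphs are cycles\<close>

text \<open>
  A longest path in a 2-regular graph closes up: the last vertex has a second neighbour on the path,
  which must be the first vertex, as the inner ones already have two neighbours.
\<close>

lemma (in graph) two_regular_connected_cycle_labelling:
  assumes con: "strongly_connected G" and deg: "\<And>u. u \<in> verts G \<Longrightarrow> card {v. u \<rightarrow> v} = 2"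
  defines "n \<equiv> card (verts G)"
  obtains x where "bij_betw x {..<n} (verts G)"
    and "\<And>i j. i < n \<Longrightarrow> j < n \<Longrightarrow> x i \<rightarrow> x j \<longleftrightarrow> j = Suc i mod n \<or> i = Suc j mod n"
proof -
  \<comment> \<open>\<open>x\<close> enumerates a path with \<open>m\<close> distinct vertices; only
    its values below \<open>m\<close> matter.\<close>
  define P where "P m x \<longleftrightarrow> x ` {..<m} \<subseteq> verts G \<and> inj_on x {..<m} \<and> (\<forall>k. Suc k < m \<longrightarrow> x k \<rightarrow> x (Suc k))"
    for m and x :: "nat \<Rightarrow> 'a"
  have P_le: "m \<le> n" if "P m x" for m x
    using that card_inj_on_le[of x "{..<m}" "verts G"] by (auto simp: P_def n_def)
  have sym: "v \<rightarrow> u" if "u \<rightarrow> v" for u v using that by (rule graph_symmetric)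
  have fin: "finite {v. u \<rightarrow> v}" for u
    by (rule finite_subset[OF _ finite_verts]) (auto dest: adj_in_verts)
  obtain v0 where v0: "v0 \<in> verts G" using con by (auto simp: strongly_connected_def)
  then have P1: "P 1 (\<lambda>_. v0)" by (auto simp: P_def inj_on_def)
  then have "\<exists>m. \<exists>x. P m x" by blast
  then obtain m where m: "\<exists>x. P m x" and max: "\<And>k. \<exists>x. P k x \<Longrightarrow> k \<le> m"
    using ex_has_greatest_nat[of "\<lambda>m. \<exists>x. P m x" _ "\<lambda>m. m" "Suc n"] P_le
    by (metis (no_types, lifting) less_Suc_eq_le)
  from m obtain x where x: "P m x" by blast
  have "1 \<le> m" using max P1 by blast
  then obtain l where l: "m = Suc l" by (cases m) auto
  have xV: "x k \<in> verts G" if "k < m" for k using x that by (auto simp: P_def)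
  have inj: "x i = x j \<longleftrightarrow> i = j" if "i < m" "j < m" for i j
    using x that by (auto simp: P_def inj_on_def)
  have adj: "x k \<rightarrow> x (Suc k)" if "Suc k < m" for k using x that by (auto simp: P_def)
  have last: "y \<in> x ` {..<m}" if "x l \<rightarrow> y" for y
  proof (rule ccontr)
    assume y: "y \<notin> x ` {..<m}"
    have "P (Suc m) (x(m := y))"
      unfolding P_def
    proof (intro conjI allI impI)
      show "(x(m := y)) ` {..<Suc m} \<subseteq> verts G"
        using xV that adj_in_verts by (auto simp: less_Suc_eq)
      show "inj_on (x(m := y)) {..<Suc m}"
        using y inj by (auto simp: inj_on_def less_Suc_eq)
      show "(x(m := y)) k \<rightarrow> (x(m := y)) (Suc k)" if "Suc k < Suc m" for k
        using that adj \<open>x l \<rightarrow> y\<close> l by (auto simp: less_Suc_eq)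
    qed
    then show False using max[of "Suc m"] by auto
  qed
  \<comment> \<open>Two neighbours do not fit into a singleton. For \<open>l = 0\<close> truncation
    gives \<open>x (l - 1) = x l\<close>, and the count still applies.\<close>
  have "\<not> {v. x l \<rightarrow> v} \<subseteq> {x (l - 1)}"
    using deg[OF xV[of l]] l card_mono[of "{x (l - 1)}" "{v. x l \<rightarrow> v}"] by auto
  then obtain i where i: "i < m" "x l \<rightarrow> x i" "x i \<noteq> x (l - 1)" using last by blast
  moreover have "x i \<noteq> x l" using adj_not_same[of "x l"] i by auto
  ultimately have il: "Suc i < l" using l by (metis Suc_lessI diff_Suc_1 less_antisym)
  \<comment> \<open>An inner \<open>x i\<close> would have three neighbours: its two on the path and
    \<open>x l\<close>, distinct because \<open>Suc i < l\<close>.\<close>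
  have "i = 0"
  proof (rule ccontr)
    assume "i \<noteq> 0"
    then have "{x (i - 1), x (Suc i), x l} \<subseteq> {v. x i \<rightarrow> v}"
      using i il l adj[of i] sym[OF adj[of "i - 1"]] sym[OF i(2)] by auto
    then have "card {x (i - 1), x (Suc i), x l} \<le> 2"
      using card_mono[OF fin] deg[OF xV[OF i(1)]] by metis
    moreover have "card {x (i - 1), x (Suc i), x l} = 3"
      using il l inj \<open>i \<noteq> 0\<close> by (auto simp: card_insert_if)
    ultimately show False by simp
  qed
  with i il l have m3: "3 \<le> m" and close: "x l \<rightarrow> x 0" by auto
  have succ: "x k \<rightarrow> x (Suc k mod m)" if "k < m" for k
    using that close adj l by (cases "Suc k = m") auto
  \<comment> \<open>The cyclic predecessor, by cases because \<open>k - 1\<close> truncates at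
    0.\<close>
  define pre where "pre k = (if k = 0 then l else k - 1)" for k :: nat
  have pre: "pre k < m" "Suc (pre k) mod m = k" if "k < m" for k
    using that l by (auto simp: pre_def)
  \<comment> \<open>Both cyclic neighbours are adjacent to \<open>x k\<close> and are distinct as
    \<open>3 \<le> m\<close>; degree 2 leaves room for no others.\<close>
  have nbrs: "{v. x k \<rightarrow> v} = {x (Suc k mod m), x (pre k)}" if k: "k < m" for k
  proof -
    have "{x (Suc k mod m), x (pre k)} \<subseteq> {v. x k \<rightarrow> v}"
      using succ[OF k] sym[OF succ[OF pre(1)[OF k]]] pre(2)[OF k] by auto
    moreover have "Suc k mod m \<noteq> pre k"
      using k m3 l by (cases "Suc k = m") (auto simp: pre_def)
    then have "card {x (Suc k mod m), x (pre k)} = 2"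
      using inj[of "Suc k mod m" "pre k"] pre[OF k] k by (auto simp: card_2_iff)
    ultimately show ?thesis using card_subset_eq[OF fin] deg[OF xV[OF k]] by metis
  qed
  \<comment> \<open>All neighbours of the cycle's vertices lie on the cycle, so by connectedness it
    spans the graph.\<close>
  have "x ` {..<m} = verts G"
  proof (rule strongly_connected_closed_set[OF con])
    show "x 0 \<in> x ` {..<m}" using l by auto
    show "x ` {..<m} \<subseteq> verts G" using xV by auto
    fix u v assume "u \<in> x ` {..<m}" "u \<rightarrow> v"
    then obtain k where "k < m" "v \<in> {v. x k \<rightarrow> v}" by auto
    then show "v \<in> x ` {..<m}" using nbrs[of k] pre[of k] by auto
  qed
  then have bij: "bij_betw x {..<m} (verts G)" using x by (auto simp: bij_betw_def P_def)
  then have mn: "m = n" using bij_betw_same_card by (fastforce simp: n_def)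
  have "x i \<rightarrow> x j \<longleftrightarrow> j = Suc i mod m \<or> i = Suc j mod m" if "i < m" "j < m" for i j
  proof
    assume "x i \<rightarrow> x j"
    then have "x j \<in> {x (Suc i mod m), x (pre i)}" using nbrs[OF that(1)] by blast
    then have "j = Suc i mod m \<or> j = pre i" using inj that pre by auto
    then show "j = Suc i mod m \<or> i = Suc j mod m" using pre that by auto
  next
    assume "j = Suc i mod m \<or> i = Suc j mod m"
    then show "x i \<rightarrow> x j" using succ that sym by auto
  qed
  with bij show ?thesis using that mn by auto
qed

text \<open>The inverse labelling sends an arc to the pair of labels of its ends, as arcs of
  \<open>cycle_graph\<close> are such pairs. This is injective because there are no parallel
  arcs.\<close>

lemma (in graph) digraph_iso_cycle_graphI:
  assumes x: "bij_betw x {..<n} (verts G)"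
    and adj: "\<And>i j. i < n \<Longrightarrow> j < n \<Longrightarrow> x i \<rightarrow> x j \<longleftrightarrow> j = Suc i mod n \<or> i = Suc j mod n"
  shows "digraph_iso G (cycle_graph n)"
proof -
  define y where "y = the_inv_into {..<n} x"
  have inj: "inj_on x {..<n}" and img: "x ` {..<n} = verts G"
    using x by (auto simp: bij_betw_def)
  have y: "bij_betw y (verts G) {..<n}" unfolding y_def using x by (rule bij_betw_the_inv_into)
  have yx: "y (x i) = i" if "i < n" for i
    using inj that by (simp add: y_def the_inv_into_f_f)
  have xy: "x (y v) = v" "y v < n" if "v \<in> verts G" for v
    using that yx unfolding img[symmetric] by auto
  \<comment> \<open>\<open>app_iso hom G\<close> has to equal \<open>cycle_graph n\<close> in every
    record field, which dictates \<open>snd\<close> and \<open>fst\<close> for head and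
    tail.\<close>
  define hom where "hom = \<lparr> iso_verts = y, iso_arcs = (\<lambda>a. (y (tail G a), y (head G a))),
    iso_head = snd, iso_tail = fst \<rparr>"
  have "inj_on (\<lambda>a. (y (tail G a), y (head G a))) (arcs G)"
  proof (rule inj_onI)
    fix a b assume ab: "a \<in> arcs G" "b \<in> arcs G"
      "(y (tail G a), y (head G a)) = (y (tail G b), y (head G b))"
    then have "tail G a = tail G b" "head G a = head G b"
      using xy(1) by (metis prod.inject wellformed)+
    with ab show "a = b" using no_multi_arcs by (auto simp: arc_to_ends_def)
  qed
  then have "digraph_isomorphism hom"
    using y by (auto simp: digraph_isomorphism_def hom_def bij_betw_def wf_digraph)
  moreover have "cycle_graph n = app_iso hom G"
  proof (rule pre_digraph.equality)
    show "verts (cycle_graph n) = verts (app_iso hom G)"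
      using y by (simp add: verts_cycle_graph hom_def bij_betw_def)
    have "arcs (app_iso hom G) = (\<lambda>(u, v). (y u, y v)) ` arcs_ends G"
      by (auto simp: hom_def arcs_ends_conv image_image)
    also have "\<dots> = {(i, j). i < n \<and> j < n \<and> x i \<rightarrow> x j}"
      using xy yx adj_in_verts by (force intro!: rev_image_eqI)
    also have "\<dots> = arcs (cycle_graph n)" using adj by (auto simp: cycle_graph_def)
    finally show "arcs (cycle_graph n) = arcs (app_iso hom G)" ..
  qed (simp_all add: hom_def cycle_graph_def)
  ultimately show ?thesis unfolding digraph_iso_def by blast
qed

section \<open>Comparison with the cycle and the case of equality\<close>

theorem theorem4:
  fixes G :: "('a,'b) pre_digraph" and n :: nat
  assumes "graph G" and "two_connected G" and "card (verts G) = n"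
  shows "harary_index G \<ge> harary_index (cycle_graph n) \<and>
         (harary_index G = harary_index (cycle_graph n) \<longleftrightarrow> digraph_iso G (cycle_graph n))"
proof -
  interpret G: graph G by fact
  have n: "3 \<le> n" and con: "strongly_connected G"
    using assms(2,3) G.symmetric_connected_imp_strongly_connected[OF G.sym_arcs]
    by (auto simp: two_connected_def)
  interpret C: graph "cycle_graph n" using n by (rule graph_cycle_graph)
  \<comment> \<open>The common bound for a single vertex: from below in \<open>G\<close>, from above
    in the cycle.\<close>
  define L where "L = layer_sum n (\<lambda>i. min (2 * i) (n - 1))"
  have ball: "min (2 * i) (n - 1) \<le> card (G.hop_ball u i - {u})" if "u \<in> verts G" for u i
    using G.two_connected_card_hop_ball[OF assms(2) that] assms(3) by simp
  have rt_G: "reciprocal_transmission G u = layer_sum n (\<lambda>i. card (G.hop_ball u i - {u}))"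
    if u: "u \<in> verts G" for u
  proof -
    \<comment> \<open>At radius \<open>n\<close> the minimum is \<open>n - 1\<close>, so the ball is
      everything and the layer formula is an equation.\<close>
    have "card (verts G - {u}) \<le> card (G.hop_ball u n - {u})"
      using ball[OF u, of n] u assms(3) by simp
    then have "G.hop_ball u n - {u} = verts G - {u}"
      using G.hop_ball_subset_verts by (intro card_seteq) auto
    moreover have "u \<in> G.hop_ball u n"
      using u by (rule G.self_in_hop_ball)
    ultimately have "verts G \<subseteq> G.hop_ball u n" by blast
    then show ?thesis
      using G.reciprocal_transmission_layer_sum(2)[OF u] assms(3) by simp
  qed
  have ge: "L \<le> reciprocal_transmission G u" if "u \<in> verts G" for u
    unfolding L_def rt_G[OF that] by (rule layer_sum_mono) (rule ball[OF that])
  have H_G: "2 * harary_index G = (\<Sum>u \<in> verts G. reciprocal_transmission G u)"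
    by (rule harary_index_conv_reciprocal_transmission) (auto intro: G.sym_digraph_axioms)
  have lower: "real n * L \<le> 2 * harary_index G"
    using sum_mono[of "verts G" "\<lambda>_. L", OF ge] assms(3) by (simp add: H_G)
  have "reciprocal_transmission (cycle_graph n) u \<le> L" if u: "u \<in> verts (cycle_graph n)" for u
  proof -
    have "reciprocal_transmission (cycle_graph n) u \<le> layer_sum n (\<lambda>i. card (C.hop_ball u i - {u}))"
      using C.reciprocal_transmission_layer_sum(1)[OF u] by (simp add: verts_cycle_graph)
    also have "\<dots> \<le> L"
      unfolding L_def
      by (rule layer_sum_mono) (use u n in \<open>intro card_hop_ball_cycle_graph, auto simp: verts_cycle_graph\<close>)
    finally show ?thesis .
  qed
  then have upper: "2 * harary_index (cycle_graph n) \<le> real n * L"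
    using sum_mono[of "verts (cycle_graph n)" _ "\<lambda>_. L"]
      harary_index_conv_reciprocal_transmission[OF C.sym_digraph_axioms]
    by (simp add: verts_cycle_graph)
  have "digraph_iso G (cycle_graph n)" if eq: "harary_index G = harary_index (cycle_graph n)"
  proof -
    have "card {v. u \<rightarrow>\<^bsub>G\<^esub> v} = 2" if u: "u \<in> verts G" for u
    proof -
      \<comment> \<open>\<open>2 * harary_index G\<close> is squeezed between
        \<open>real n * L\<close> and itself, so every vertex attains its lower bound
        \<open>L\<close>.\<close>
      have "(\<Sum>u \<in> verts G. L) = (\<Sum>u \<in> verts G. reciprocal_transmission G u)"
        using eq lower upper assms(3) H_G by simp
      then have "L = reciprocal_transmission G u"
        by (rule sum_mono_inv) (use ge u in auto)
      \<comment> \<open>At index 1 the minimum is 2 by \<open>3 \<le> n\<close>, and the ball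
        without its centre is the neighbourhood, so this determines the degree.\<close>
      then have "min (2 * 1) (n - 1) = card (G.hop_ball u 1 - {u})"
        unfolding L_def rt_G[OF u]
        by (rule layer_sum_eq_imp_eq[rotated]) (use ball[OF u] n in auto)
      moreover have "G.hop_ball u 1 - {u} = {v. u \<rightarrow>\<^bsub>G\<^esub> v}"
        using G.hop_ball_Suc[of u 0] G.hop_ball_0[OF u] G.adj_not_same by auto
      ultimately show ?thesis using n by simp
    qed
    then obtain x where "bij_betw x {..<n} (verts G)"
      "\<And>i j. i < n \<Longrightarrow> j < n \<Longrightarrow> x i \<rightarrow>\<^bsub>G\<^esub> x j \<longleftrightarrow> j = Suc i mod n \<or> i = Suc j mod n"
      using G.two_regular_connected_cycle_labelling[OF con] assms(3) by metis
    then show ?thesis by (rule G.digraph_iso_cycle_graphI)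
  qed
  then show ?thesis
    using lower upper harary_index_digraph_iso[OF assms(1) C.graph_axioms] by auto
qed

end
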